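(* Let $R_d$ denote the optimal expected rendezvous time over admissible oblivious self-distance strategies at initial separation $2d$. Then $R_d=\Omega(d^2)$ for every $d\ge 1$; that is, there is a universal constant $c>0$ such that $R_d\ge c\,d^2$ for every integer $d\ge1$ (equivalently, $\mathbb E[\mathcal T_d(a)]\ge c\,d^2$ for every integer $d\geq 1$ and every admissible strategy $a$).
   Context: An admissible strategy is a sequence $a=(a_i)_{i\ge 0}$ with $a_i\in[0,1]$ and $a_0=\tfrac12$; $\mathcal A$ is the set of admissible strategies. Extend $a$ to a signed sequence $(b_i)_{i\in\mathbb Z}$ by $b_i=a_i$ for $i\ge0$ and $b_i=1-a_{-i}$ for $i<0$. Two independent Markov chains $(X_t)_{t\ge0},(Y_t)_{t\ge 0}$ on $\mathbb Z$ start at $X_0=Y_0=0$; each moves from $k$ to $k+1$ with probability $b_k$ and to $k-1$ with probability $1-b_k$. (These are the displacements of two agents from their starting points $-d$ and $d$.) For an integer $d\ge1$ the rendezvous time is $\mathcal T_d(a)=\inf\{t\ge0: X_t=Y_t+2d\}$ (with value $\infty$ if there is no such $t$), and $$R_d=\inf_{a\in\mathcal A}\mathbb E[\mathcal T_d(a)].$$ *)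

theory Defs
  imports "HOL-Probability.Probability"
begin

definition admissible :: "(nat \<Rightarrow> real) \<Rightarrow> bool" where
  "admissible a \<longleftrightarrow> (\<forall>i. 0 \<le> a i \<and> a i \<le> 1) \<and> a 0 = 1 / 2"

definition signed :: "(nat \<Rightarrow> real) \<Rightarrow> int \<Rightarrow> real" where
  "signed a i = (if 0 \<le> i then a (nat i) else 1 - a (nat (- i)))"

lemma signed_bounds: "admissible a \<Longrightarrow> 0 \<le> signed a i \<and> signed a i \<le> 1"
  by (auto simp: admissible_def signed_def)

text \<open>
  \<open>bernoulli_pmf\<close> clamps its parameter to the unit interval; by \<open>signed_bounds\<close> this has no
  effect for admissible strategies.
\<close>

definition step :: "(int \<Rightarrow> real) \<Rightarrow> int \<Rightarrow> int pmf" where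
  "step b k = map_pmf (\<lambda>up. if up then k + 1 else k - 1) (bernoulli_pmf (b k))"

lemma pmf_step:
  assumes "0 \<le> b k" "b k \<le> 1"
  shows "pmf (step b k) j = (if j = k + 1 then b k else if j = k - 1 then 1 - b k else 0)"
proof -
  have "pmf (step b k) j = measure (measure_pmf (bernoulli_pmf (b k)))
      ((\<lambda>up. if up then k + 1 else k - 1) -` {j})"
    by (simp add: step_def pmf_map)
  also have "(\<lambda>up. if up then k + 1 else k - 1) -` {j} =
      (if j = k + 1 then {True} else if j = k - 1 then {False} else {})"
    by (auto split: if_splits)
  finally show ?thesis
    using assms by (auto simp: measure_pmf_single)
qed

text \<open>
  \<open>walk_kernel b n x\<close> is the conditional law of the position at time \<open>n\<close> given the
  earlier positions \<open>x 0\<close>, ..., \<open>x (n - 1)\<close>.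
\<close>

definition walk_kernel :: "(int \<Rightarrow> real) \<Rightarrow> nat \<Rightarrow> (nat \<Rightarrow> int) \<Rightarrow> int measure" where
  "walk_kernel b n x = measure_pmf (case n of 0 \<Rightarrow> return_pmf 0 | Suc m \<Rightarrow> step b (x m))"

interpretation walk: Ionescu_Tulcea "walk_kernel b" "\<lambda>_. count_space UNIV" for b
proof (rule Ionescu_Tulcea.intro)
  fix n :: nat
  show "walk_kernel b n \<in> measurable (PiM {0..<n} (\<lambda>_. count_space UNIV))
      (subprob_algebra (count_space UNIV))"
  proof (cases n)
    case 0
    then show ?thesis
      by (simp add: walk_kernel_def[abs_def] measure_pmf_in_subprob_algebra)
  next
    case (Suc m)
    have "(\<lambda>x. x m) \<in> measurable (PiM {0..<Suc m} (\<lambda>_. count_space UNIV)) (count_space UNIV)"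
      by (rule measurable_component_singleton) simp
    then have "(\<lambda>x. measure_pmf (step b (x m))) \<in>
        measurable (PiM {0..<Suc m} (\<lambda>_. count_space UNIV)) (subprob_algebra (count_space UNIV))"
      by (rule measurable_compose) (simp add: measure_pmf_in_subprob_algebra)
    with Suc show ?thesis
      by (simp add: walk_kernel_def[abs_def])
  qed
qed (unfold walk_kernel_def, rule prob_space_measure_pmf)

text \<open>
  The law, on trajectories, of the Markov chain started at \<open>0\<close> with transitions \<open>step b\<close>;
  \<open>emeasure_walk_law_path\<close> below computes its finite-dimensional distributions.
\<close>

definition walk_law :: "(int \<Rightarrow> real) \<Rightarrow> (nat \<Rightarrow> int) measure" where
  "walk_law b = walk.PF.lim b"

lemma sets_walk_law [measurable_cong]: "sets (walk_law b) = sets (PiM UNIV (\<lambda>_. count_space UNIV))"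
  by (simp add: walk_law_def)

lemma space_walk_law [simp]: "space (walk_law b) = UNIV"
  by (simp add: walk_law_def space_PiM)

lemma emeasure_walk_law_path:
  "emeasure (walk_law b) {x. \<forall>i\<le>n. x i = w i} =
    (if w 0 = 0 then \<Prod>i<n. ennreal (pmf (step b (w i)) (w (Suc i))) else 0)"
proof -
  let ?M = "\<lambda>_::nat. count_space (UNIV :: int set)"
  let ?S = "\<lambda>n. {restrict w {0..<n}}"
  let ?Q = "\<lambda>n. walk.C b 0 n (\<lambda>_. undefined)"
  have S: "?S n = PiE {0..<n} (\<lambda>i. {w i})" for n
    by (auto simp: fun_eq_iff PiE_iff extensional_def)
  have S_sets [measurable]: "?S n \<in> sets (PiM {0..<n} ?M)" for n
    unfolding S by (rule sets_PiM_I_finite) auto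
  have undef: "(\<lambda>_. undefined) \<in> space (PiM {0..<0} ?M)"
    by (simp add: space_PiM)
  have Q_sets: "sets (?Q n) = sets (PiM {0..<n} ?M)" for n
    using walk.sets_C[OF undef] by simp
  have Q_space: "space (?Q n) = space (PiM {0..<n} ?M)" for n
    using walk.space_C[OF undef] by simp
  have rec: "emeasure (?Q (Suc n)) (?S (Suc n)) =
      emeasure (?Q n) (?S n) * emeasure (walk_kernel b n w) {w n}" for n
  proof -
    have "emeasure (?Q (Suc n)) (?S (Suc n)) = (\<integral>\<^sup>+x. emeasure (walk.eP b n x) (?S (Suc n)) \<partial>?Q n)"
      unfolding walk.C.simps add_0
    proof (rule emeasure_bind)
      show "space (?Q n) \<noteq> {}"
        by (simp add: Q_space space_PiM_empty_iff)
      show "walk.eP b n \<in> measurable (?Q n) (subprob_algebra (PiM {0..<Suc n} ?M))"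
        using walk.measurable_eP measurable_cong_sets[OF Q_sets refl] by blast
    qed (rule S_sets)
    also have "\<dots> = (\<integral>\<^sup>+x. emeasure (walk_kernel b n w) {w n} * indicator (?S n) x \<partial>?Q n)"
    proof (rule nn_integral_cong)
      fix x assume "x \<in> space (?Q n)"
      then have x: "x \<in> space (PiM {0..<n} ?M)"
        by (simp add: Q_space)
      have ext: "x i = undefined" if "\<not> i < n" for i
        using x that by (auto simp: space_PiM PiE_iff extensional_def)
      have *: "fun_upd x n -` ?S (Suc n) = (if x \<in> ?S n then {w n} else {})"
      proof (intro set_eqI)
        fix v
        have "x(n := v) = restrict w {0..<Suc n} \<longleftrightarrow> v = w n \<and> x = restrict w {0..<n}"
        proof
          assume A: "x(n := v) = restrict w {0..<Suc n}"
          have "x i = restrict w {0..<n} i" for i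
            using fun_cong[OF A, of i] ext[of i] by (auto split: if_splits)
          moreover have "v = w n"
            using fun_cong[OF A, of n] by simp
          ultimately show "v = w n \<and> x = restrict w {0..<n}"
            by auto
        qed (auto simp: fun_eq_iff)
        then show "v \<in> fun_upd x n -` ?S (Suc n) \<longleftrightarrow> v \<in> (if x \<in> ?S n then {w n} else {})"
          by auto
      qed
      have "walk_kernel b n x = walk_kernel b n w" if "x \<in> ?S n"
        using that by (auto simp: walk_kernel_def split: nat.split)
      then show "emeasure (walk.eP b n x) (?S (Suc n)) =
          emeasure (walk_kernel b n w) {w n} * indicator (?S n) x"
        unfolding walk.emeasure_eP[OF x S_sets] by (simp add: *)
    qed
    also have "\<dots> = emeasure (?Q n) (?S n) * emeasure (walk_kernel b n w) {w n}"
      by (subst nn_integral_cmult_indicator) (simp_all add: Q_sets mult.commute)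
    finally show ?thesis .
  qed
  have Q: "emeasure (?Q (Suc n)) (?S (Suc n)) =
      (if w 0 = 0 then \<Prod>i<n. ennreal (pmf (step b (w i)) (w (Suc i))) else 0)" for n
  proof (induction n)
    case 0
    have "emeasure (?Q 0) (?S 0) = 1"
      using undef S_sets[of 0] by (simp add: restrict_def)
    then show ?case
      by (subst rec) (simp add: walk_kernel_def emeasure_pmf_single)
  next
    case (Suc n)
    show ?case
      by (subst rec) (simp add: Suc walk_kernel_def emeasure_pmf_single del: walk.C.simps)
  qed
  have "{x. \<forall>i\<le>n. x i = w i} = walk.PF.emb UNIV {0..<Suc n} (?S (Suc n))"
    by (auto simp: S prod_emb_def space_PiM PiE_iff less_Suc_eq_le)
  then have "emeasure (walk_law b) {x. \<forall>i\<le>n. x i = w i} = walk.CI b {0..<Suc n} (?S (Suc n))"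
    unfolding walk_law_def using walk.lim[OF _ S_sets] by simp
  also have "\<dots> = emeasure (?Q (Suc n)) (?S (Suc n))"
    using S_sets[of "Suc n"] sets.sets_into_space[OF S_sets[of "Suc n"]]
    by (subst walk.emeasure_CI[of _ "Suc n"]) (simp_all add: prod_emb_id space_PiM)
  finally show ?thesis
    by (simp only: Q)
qed

lemma prob_space_walk_law: "prob_space (walk_law b)"
proof (rule prob_space_distrD)
  let ?M = "\<lambda>_::nat. count_space (UNIV :: int set)"
  show "(\<lambda>x. restrict x {}) \<in> measurable (walk_law b) (PiM {} ?M)"
    unfolding measurable_cong_sets[OF sets_walk_law refl] by (rule measurable_restrict_subset) simp
  show "prob_space (distr (walk_law b) (PiM {} ?M) (\<lambda>x. restrict x {}))"
    unfolding walk_law_def by (subst walk.distr_lim) (simp_all add: walk.PF.prob_space_P)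
qed

definition rendezvous_time :: "nat \<Rightarrow> (nat \<Rightarrow> int) \<Rightarrow> (nat \<Rightarrow> int) \<Rightarrow> enat" where
  "rendezvous_time d x y = (INF t\<in>{t. x t = y t + 2 * int d}. enat t)"

text \<open>The two displacements are independent, so their joint law is the product measure.\<close>

definition expected_rendezvous_time :: "nat \<Rightarrow> (nat \<Rightarrow> real) \<Rightarrow> ennreal" where
  "expected_rendezvous_time d a =
    (\<integral>\<^sup>+(x, y). ennreal_of_enat (rendezvous_time d x y)
      \<partial>(walk_law (signed a) \<Otimes>\<^sub>M walk_law (signed a)))"

definition optimal_rendezvous_time :: "nat \<Rightarrow> ennreal" where
  "optimal_rendezvous_time d = (INF a\<in>{a. admissible a}. expected_rendezvous_time d a)"

lemma measurable_rendezvous_time: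
  "(\<lambda>(x, y). ennreal_of_enat (rendezvous_time d x y)) \<in>
    borel_measurable (walk_law b \<Otimes>\<^sub>M walk_law b')"
proof -
  have coord [measurable]: "(\<lambda>x. x t) \<in> measurable (walk_law b) (count_space UNIV)" for b t
    by measurable
  have eq: "ennreal_of_enat (rendezvous_time d x y) =
      (INF t. if x t = y t + 2 * int d then of_nat t else \<top>)" for x y
  proof (cases "\<exists>t. x t = y t + 2 * int d")
    case True
    define T where "T = (LEAST t. x t = y t + 2 * int d)"
    have T: "x T = y T + 2 * int d" "\<And>t. x t = y t + 2 * int d \<Longrightarrow> T \<le> t"
      using True by (auto simp: T_def intro: LeastI_ex Least_le)
    have "rendezvous_time d x y = enat T"
      unfolding rendezvous_time_def
      by (rule antisym) (auto intro!: INF_lower2[of T] INF_greatest simp: T)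
    moreover have "(INF t. if x t = y t + 2 * int d then of_nat t else \<top>) = (of_nat T :: ennreal)"
      by (rule antisym) (rule INF_lower2[of T], auto intro!: INF_greatest simp: T simp del: if_image_distrib)
    ultimately show ?thesis
      by simp
  next
    case False
    then show ?thesis
      by (simp add: rendezvous_time_def top_enat_def)
  qed
  show ?thesis
    unfolding eq split_beta' by measurable
qed

end

(*
  Meeting forces X to reach d or Y to reach -d, so by independence it suffices that a single
  symmetric walk avoids d for d^2/8 steps with probability bounded below.  Let H(x) be the
  probability, from x, of reaching d before a geometric clock of rate 1/(2d^2) rings.  If
  H(0) > 3/4, symmetry propagates H > 1/2 to all of [-d, d].  In terms of the conductances c_i
  of the edges (i, i+1) and (-i-1, -i), the increments of H carry a flux growing by at least
  (1/(4d^2)) c_i at each edge left of 0, so all edges right of 0 carry at least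
  (1/(4d^2)) (sum c_i); since an increment is flux divided by conductance, Cauchy-Schwarz gives
  H(d) - H(0) >= (1/(4d^2)) (sum c_i) (sum 1/c_i) >= 1/4, a contradiction.
*)
theory Submission
  imports Defs
begin

section \<open>Recursions for survival below \<open>d\<close> and for killed hitting of
  \<open>d\<close>\<close>

text \<open>Recursing on the first step keeps the estimates free of measure theory;
  \<open>survival_le_walk_law\<close> transfers them to trajectories.\<close>

primrec survival :: "(int \<Rightarrow> real) \<Rightarrow> int \<Rightarrow> nat \<Rightarrow> int \<Rightarrow> real" where
  "survival b d 0 x = (if x < d then 1 else 0)"
| "survival b d (Suc n) x =
    (if x < d then b x * survival b d n (x + 1) + (1 - b x) * survival b d n (x - 1) else 0)"

text \<open>
  The probability of reaching \<open>d\<close> within \<open>n\<close> steps before an independent clock kills the walk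
  (survival probability \<open>s\<close> per step). Sending the walk from \<open>- d\<close> and beyond to \<open>1 - d\<close>
  only increases it, and makes its limit in \<open>n\<close> the solution of a finite system.
\<close>

primrec discounted_hit :: "(int \<Rightarrow> real) \<Rightarrow> int \<Rightarrow> real \<Rightarrow> nat \<Rightarrow> int \<Rightarrow> real" where
  "discounted_hit b d s 0 x = (if d \<le> x then 1 else 0)"
| "discounted_hit b d s (Suc n) x =
    (if d \<le> x then 1
     else if x \<le> - d then s * discounted_hit b d s n (1 - d)
     else s * (b x * discounted_hit b d s n (x + 1) + (1 - b x) * discounted_hit b d s n (x - 1)))"

text \<open>Cauchy-Schwarz for the square roots of c(i) and 1/c(i), whose products are 1. The lower
  bound no longer involves c, which frees the final estimate from the strategy.\<close>

lemma square_le_sum_mult_sum_inverse: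
  fixes c :: "nat \<Rightarrow> real"
  assumes "\<And>i. i < d \<Longrightarrow> 0 < c i"
  shows "(real d)\<^sup>2 \<le> (\<Sum>i<d. c i) * (\<Sum>i<d. 1 / c i)"
proof -
  have "(\<Sum>i<d. sqrt (c i) * sqrt (1 / c i))\<^sup>2 \<le> (\<Sum>i<d. (sqrt (c i))\<^sup>2) * (\<Sum>i<d. (sqrt (1 / c i))\<^sup>2)"
    by (rule Cauchy_Schwarz_ineq_sum)
  moreover have "(\<Sum>i<d. sqrt (c i) * sqrt (1 / c i)) = (\<Sum>i<d. 1)"
    using assms by (intro sum.cong) (auto simp: real_sqrt_mult[symmetric] less_imp_neq[symmetric])
  moreover have "(\<Sum>i<d. (sqrt (c i))\<^sup>2) = (\<Sum>i<d. c i)" "(\<Sum>i<d. (sqrt (1 / c i))\<^sup>2) = (\<Sum>i<d. 1 / c i)"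
    using assms by (auto intro!: sum.cong simp: less_imp_le)
  ultimately show ?thesis
    by simp
qed

section \<open>Reflection-symmetric walks and the limiting hitting probability\<close>

text \<open>By \<open>b_minus\<close>, the reflected walk -X has the same transitions as X.\<close>

locale symmetric_walk =
  fixes b :: "int \<Rightarrow> real"
  assumes b_ge_0: "0 \<le> b x" and b_le_1: "b x \<le> 1" and b_minus: "b (- x) = 1 - b x"
begin

lemma b_0: "b 0 = 1 / 2"
  using b_minus[of 0] by simp

lemma average_mono:
  "f (x + 1) \<le> g (x + 1) \<Longrightarrow> f (x - 1) \<le> g (x - 1) \<Longrightarrow>
    b x * f (x + 1) + (1 - b x) * f (x - 1) \<le> b x * g (x + 1) + (1 - b x) * (g (x - 1) :: real)"
  by (intro add_mono mult_left_mono) (auto simp: b_ge_0 b_le_1)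

lemma discounted_hit_bounds:
  assumes "0 \<le> s" "s \<le> 1"
  shows "0 \<le> discounted_hit b d s n x \<and> discounted_hit b d s n x \<le> 1"
proof (induction n arbitrary: x)
  case (Suc n)
  let ?f = "discounted_hit b d s n"
  have "0 \<le> b x * ?f (x + 1) + (1 - b x) * ?f (x - 1)"
       "b x * ?f (x + 1) + (1 - b x) * ?f (x - 1) \<le> 1"
    using average_mono[of "\<lambda>_. 0" x ?f] average_mono[of ?f x "\<lambda>_. 1"] Suc by auto
  with Suc assms show ?case
    by (auto intro!: mult_nonneg_nonneg mult_le_one)
qed simp

text \<open>The one-step operator is monotone, and the initial function lies below its
  image.\<close>

lemma discounted_hit_mono:
  assumes "0 \<le> s" "s \<le> 1"
  shows "discounted_hit b d s n x \<le> discounted_hit b d s (Suc n) x"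
proof (induction n arbitrary: x)
  case 0
  show ?case
    using discounted_hit_bounds[OF assms, of d 0] discounted_hit_bounds[OF assms, of d "Suc 0" x]
    by (auto simp del: discounted_hit.simps(2)) (auto split: if_splits)
next
  case (Suc n)
  show ?case
    unfolding discounted_hit.simps(2)[of b d s "Suc n" x] discounted_hit.simps(2)[of b d s n x]
    using Suc assms by (auto intro!: mult_left_mono average_mono simp del: discounted_hit.simps(2))
qed

text \<open>Bounded monotone convergence at each site; passing to the limit in the recursion turns
  it into fixed-point equations.\<close>

lemma discounted_hit_limit:
  assumes "0 \<le> s" "s \<le> 1"
  obtains H where
    "\<And>x. 0 \<le> H x" "\<And>x. H x \<le> 1" "\<And>x. d \<le> x \<Longrightarrow> H x = 1"
    "\<And>x. x < d \<Longrightarrow> x \<le> - d \<Longrightarrow> H x = s * H (1 - d)"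
    "\<And>x. x < d \<Longrightarrow> - d < x \<Longrightarrow> H x = s * (b x * H (x + 1) + (1 - b x) * H (x - 1))"
proof -
  let ?f = "discounted_hit b d s"
  have "\<exists>L. (\<lambda>n. ?f n x) \<longlonglongrightarrow> L" for x
  proof -
    have "incseq (\<lambda>n. ?f n x)"
      by (rule incseq_SucI) (rule discounted_hit_mono[OF assms])
    then show ?thesis
      using incseq_convergent[of "\<lambda>n. ?f n x" 1] discounted_hit_bounds[OF assms] by metis
  qed
  then obtain H where H: "\<And>x. (\<lambda>n. ?f n x) \<longlonglongrightarrow> H x"
    by metis
  have H_Suc: "(\<lambda>n. ?f (Suc n) x) \<longlonglongrightarrow> H x" for x
    using H[of x] by (rule LIMSEQ_Suc)
  show thesis
  proof
    show "0 \<le> H x" "H x \<le> 1" for x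
      using H[of x] discounted_hit_bounds[OF assms] by (auto intro: LIMSEQ_le_const LIMSEQ_le_const2)
    show "H x = 1" if "d \<le> x" for x
      using H_Suc[of x] that by (simp add: LIMSEQ_const_iff)
    show "H x = s * H (1 - d)" if "x < d" "x \<le> - d" for x
    proof (rule LIMSEQ_unique[OF H_Suc])
      show "(\<lambda>n. ?f (Suc n) x) \<longlonglongrightarrow> s * H (1 - d)"
        using that by (auto intro!: tendsto_intros H)
    qed
    show "H x = s * (b x * H (x + 1) + (1 - b x) * H (x - 1))" if "x < d" "- d < x" for x
    proof (rule LIMSEQ_unique[OF H_Suc])
      show "(\<lambda>n. ?f (Suc n) x) \<longlonglongrightarrow> s * (b x * H (x + 1) + (1 - b x) * H (x - 1))"
        using that by (auto intro!: tendsto_intros H)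
    qed
  qed
qed

section \<open>The hitting probability from 0\<close>

text \<open>A discrete maximum principle: the average over the neighbours is f(x)/s > f(x), so some
  neighbour exceeds f(x), and the left one does not. It propagates monotonicity to the
  right.\<close>

lemma next_increment_pos:
  fixes f :: "int \<Rightarrow> real"
  assumes "0 < s" "s < 1" "f x = s * (b x * f (x + 1) + (1 - b x) * f (x - 1))"
    and "f (x - 1) \<le> f x" "0 < f x"
  shows "f x < f (x + 1)"
proof (rule ccontr)
  assume "\<not> f x < f (x + 1)"
  then have "b x * f (x + 1) + (1 - b x) * f (x - 1) \<le> b x * f x + (1 - b x) * f x"
    using assms b_ge_0[of x] b_le_1[of x] by (intro add_mono mult_left_mono) auto
  also have "\<dots> = f x"
    by (simp add: algebra_simps)
  finally have "f x \<le> s * f x"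
    using assms(1,3) by (metis mult_left_mono less_imp_le)
  moreover have "s * f x < f x"
    using assms(2,5) by simp
  ultimately show False
    by simp
qed

lemma discounted_hit_limit_0_le:
  fixes d :: nat and H :: "int \<Rightarrow> real"
  assumes d: "1 \<le> d" and s: "s = 1 - 1 / (2 * (real d)\<^sup>2)"
    and bounds: "\<And>x. 0 \<le> H x" "\<And>x. H x \<le> 1"
    and left: "H (- int d) = s * H (1 - int d)"
    and eq: "\<And>x. x < int d \<Longrightarrow> - int d < x \<Longrightarrow> H x = s * (b x * H (x + 1) + (1 - b x) * H (x - 1))"
  shows "H 0 \<le> 3 / 4"
proof (rule ccontr)
  assume H0: "\<not> H 0 \<le> 3 / 4"
  have s01: "0 < s" "s < 1"
  proof -
    have "1 \<le> (real d)\<^sup>2"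
      using d by simp
    then have "1 < 2 * (real d)\<^sup>2"
      by linarith
    then have "1 / (2 * (real d)\<^sup>2) < 1"
      by (rule divide_less_eq_1_pos[THEN iffD2, rotated]) (use d in simp)
    moreover have "0 < 1 / (2 * (real d)\<^sup>2)"
      using d by simp
    ultimately show "0 < s" "s < 1"
      unfolding s by linarith+
  qed
  \<comment> \<open>Symmetrizing provides a starting point for monotonicity: \<open>E\<close> solves
    the same equation as \<open>H\<close>, and evenness reduces it at 0 to E(0) = s E(1).\<close>
  define E where "E x = H x + H (- x)" for x
  have E_eq: "E x = s * (b x * E (x + 1) + (1 - b x) * E (x - 1))" if "- int d < x" "x < int d" for x
  proof -
    have "H (- x) = s * ((1 - b x) * H (- (x - 1)) + b x * H (- (x + 1)))"
      using eq[of "- x"] that by (simp add: b_minus)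
    then show ?thesis
      unfolding E_def eq[OF that(2,1)] distrib_left by (simp only: add_ac)
  qed
  have E_mono: "E (int n) < E (int n + 1) \<and> E 0 \<le> E (int n)" if "n < d" for n
    using that
  proof (induction n)
    case 0
    have "E (- 1) = E 1"
      by (simp add: E_def)
    then have "E 0 = s * E 1"
      using E_eq[of 0] d by (simp add: b_0)
    moreover have "0 < E 0"
      using H0 by (simp add: E_def)
    ultimately show ?case
      using s01 by (simp add: mult_less_cancel_right2 zero_less_mult_iff)
  next
    case (Suc n)
    then have "E 0 \<le> E (int n)" "E (int n) < E (int n + 1)"
      by auto
    moreover have "0 < E 0"
      using H0 by (simp add: E_def)
    ultimately show ?case
      using next_increment_pos[of s E "int n + 1"] E_eq[of "int n + 1"] Suc.prems s01
      by (auto simp: add.commute)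
  qed
  have E_ge: "E 0 \<le> E (int n)" if "n \<le> d" for n
    using E_mono[of n] E_mono[of "n - 1"] that d
    by (cases "n = d") (auto simp: of_nat_diff)
  \<comment> \<open>E(x) \<ge> E(0) = 2 H(0) > 3/2, while H(-x) \<le> 1.\<close>
  have H_half: "1 / 2 < H x" if "- int d \<le> x" "x \<le> int d" for x
  proof -
    have "E 0 \<le> E x"
      using E_ge[of "nat \<bar>x\<bar>"] that by (cases "0 \<le> x") (auto simp: E_def add.commute)
    then show ?thesis
      using H0 bounds(2)[of "- x"] by (simp add: E_def)
  qed
  \<comment> \<open>The reset at -d starts this induction, since H(-d) = s H(1 - d) < H(1 - d);
    \<open>H_half\<close> supplies the positivity needed to continue.\<close>
  have H_mono: "H (int n - int d) < H (int n - int d + 1)" if "n < 2 * d" for n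
    using that
  proof (induction n)
    case 0
    then show ?case
      using left s01 H_half[of "1 - int d"] d by (simp add: mult_less_cancel_right2)
  next
    case (Suc n)
    then show ?case
      using next_increment_pos[of s H "int n - int d + 1"] eq[of "int n - int d + 1"] s01
        H_half[of "int n - int d + 1"]
      by (auto simp: algebra_simps)
  qed
  have incr: "H x < H (x + 1)" if "- int d \<le> x" "x < int d" for x
    using H_mono[of "nat (x + int d)"] that by simp
  \<comment> \<open>A site with b(x) = 0 would force H(x) \<le> H(x - 1). So the contradiction
    hypothesis itself rules out one-way sites, and the conductances below are finite and
    positive.\<close>
  have b_pos: "0 < b x" if "- int d < x" "x < int d" for x
  proof (rule ccontr)
    assume "\<not> 0 < b x"
    then have "H x = s * H (x - 1)"
      using eq[of x] that b_ge_0[of x] by simp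
    also have "\<dots> \<le> H (x - 1)"
      using s01 bounds(1)[of "x - 1"] by (simp add: mult_left_le_one_le)
    finally show False
      using incr[of "x - 1"] that by simp
  qed
  have b_lt_1: "b x < 1" if "- int d < x" "x < int d" for x
    using b_pos[of "- x"] b_minus[of x] that by simp
  let ?k = "(1 - s) / 2"
  \<comment> \<open>The gain is exactly (1/s - 1) H(x); here 1/s - 1 \<ge> 1 - s and H(x) >
    1/2.\<close>
  have flux: "(1 - b x) * (H x - H (x - 1)) + ?k \<le> b x * (H (x + 1) - H x)"
    if "- int d < x" "x < int d" for x
  proof -
    have "H x / s = b x * H (x + 1) + (1 - b x) * H (x - 1)"
      using eq[of x] that s01 by (simp add: field_simps)
    then have "b x * (H (x + 1) - H x) - (1 - b x) * (H x - H (x - 1)) = (1 / s - 1) * H x"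
      by (simp add: algebra_simps)
    moreover have "(1 - s) * (1 / 2) \<le> (1 / s - 1) * H x"
    proof (rule mult_mono)
      show "1 - s \<le> 1 / s - 1"
        using s01 sum_squares_ge_zero[of "s - 1" 0] by (simp add: field_simps power2_eq_square)
    qed (use s01 H_half[of x] that in auto)
    ultimately show ?thesis
      by linarith
  qed
  \<comment> \<open>Conductances: \<open>c (i - 1) : c i\<close> is the ratio of the inward and outward probabilities at \<open>\<plusminus> i\<close>.\<close>
  define c where "c = rec_nat 1 (\<lambda>i r. r * (b (int i + 1) / (1 - b (int i + 1))))"
  have c_Suc: "c (Suc i) * (1 - b (int i + 1)) = c i * b (int i + 1)"
    if "Suc i < d" for i
    using b_lt_1[of "int i + 1"] that by (auto simp: c_def)
  have c0: "c 0 = 1"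
    by (simp add: c_def)
  have c_pos: "0 < c i" if "i < d" for i
    using that
  proof (induction i)
    case (Suc i)
    then show ?case
      using b_pos[of "int i + 1"] b_lt_1[of "int i + 1"] by (simp add: c_def)
  qed (simp add: c_def)
  define L where "L i = H (- int i) - H (- int (Suc i))" for i
  define R where "R i = H (int i + 1) - H (int i)" for i
  \<comment> \<open>This is \<open>flux\<close> at -(i + 1) scaled by c(i)/q, kept multiplied by q
    until the end. The gain k c(i)/q is at least k c(i) because q \<le> 1.\<close>
  have L_step: "c (Suc i) * L (Suc i) + ?k * c i \<le> c i * L i" if "Suc i < d" for i
  proof -
    define q where "q = 1 - b (int i + 1)"
    have q: "0 < q" "q \<le> 1" "b (- int (Suc i)) = q"
      using b_lt_1[of "int i + 1"] b_ge_0[of "int i + 1"] b_minus[of "int (Suc i)"] that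
      by (auto simp: q_def add.commute)
    have k: "0 \<le> ?k"
      using s01 by simp
    have "1 - q = b (int i + 1)"
      by (simp add: q_def)
    then have "b (int i + 1) * L (Suc i) + ?k \<le> q * L i"
      using flux[of "- int (Suc i)"] that unfolding L_def q(3) by simp
    then have "c i * (b (int i + 1) * L (Suc i) + ?k) \<le> c i * (q * L i)"
      using c_pos[of i] that by (intro mult_left_mono) auto
    then have "c (Suc i) * q * L (Suc i) + c i * ?k \<le> q * (c i * L i)"
      using c_Suc[OF that] unfolding q_def[symmetric] by (simp add: algebra_simps)
    moreover have "q * (c i * ?k) \<le> c i * ?k"
      using q(1,2) k c_pos[of i] that by (intro mult_left_le_one_le mult_nonneg_nonneg) auto
    moreover have "q * (c (Suc i) * L (Suc i) + ?k * c i) = c (Suc i) * q * L (Suc i) + q * (c i * ?k)"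
      by (simp only: distrib_left mult_ac)
    ultimately have "q * (c (Suc i) * L (Suc i) + ?k * c i) \<le> q * (c i * L i)"
      by linarith
    then show ?thesis
      using q(1) by simp
  qed
  \<comment> \<open>Induction inward from the edge (-d, 1 - d), where the reset gives the increment
    (1 - s) H(1 - d) \<ge> k.\<close>
  have L_sum: "?k * (\<Sum>i=d - Suc n..<d. c i) \<le> c (d - Suc n) * L (d - Suc n)" if "n < d" for n
    using that
  proof (induction n)
    case 0
    have "?k \<le> L (d - 1)"
    proof -
      have "(1 - s) * (1 / 2) \<le> (1 - s) * H (1 - int d)"
        using s01 H_half[of "1 - int d"] d by (intro mult_left_mono) auto
      also have "\<dots> = L (d - 1)"
        using left d by (simp add: L_def algebra_simps of_nat_diff)
      finally show ?thesis
        by simp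
    qed
    moreover have "{d - Suc 0..<d} = {d - 1}"
      using d by auto
    ultimately show ?case
      using mult_left_mono[of ?k "L (d - 1)" "c (d - 1)"] c_pos[of "d - 1"] d
      by (simp add: mult.commute)
  next
    case (Suc n)
    define m where "m = d - Suc (Suc n)"
    have m: "d - Suc n = Suc m" "Suc m < d"
      using Suc.prems by (auto simp: m_def)
    have "(\<Sum>i=m..<d. c i) = c m + (\<Sum>i=Suc m..<d. c i)"
      using m by (intro sum.atLeast_Suc_lessThan) auto
    then show ?case
      using Suc L_step[of m] m unfolding m_def[symmetric] by (simp add: distrib_left)
  qed
  define S where "S = (\<Sum>i<d. c i)"
  have L0: "?k * S \<le> L 0"
    using L_sum[of "d - 1"] d by (simp add: S_def c0 lessThan_atLeast0)
  \<comment> \<open>At 0 both directions have probability 1/2, so the flux arriving from the left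
    passes on to the right; further gains are discarded.\<close>
  have R_ge: "L 0 \<le> c i * R i" if "i < d" for i
    using that
  proof (induction i)
    case 0
    then show ?case
      using flux[of 0] s01 by (simp add: b_0 c0 L_def R_def field_simps)
  next
    case (Suc i)
    define p where "p = b (int i + 1)"
    have p: "p < 1"
      using b_lt_1[of "int i + 1"] Suc.prems by (simp add: p_def)
    have p': "0 < p"
      using b_pos[of "int i + 1"] Suc.prems by (simp add: p_def)
    have "(1 - p) * R i + ?k \<le> p * R (Suc i)"
      using flux[of "int i + 1"] Suc.prems unfolding p_def R_def by (simp add: algebra_simps)
    then have "(1 - p) * R i \<le> p * R (Suc i)"
      by (rule order_trans[rotated]) (use s01 in simp)
    then have "c (Suc i) * ((1 - p) * R i) \<le> c (Suc i) * (p * R (Suc i))"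
      using c_pos[of "Suc i"] Suc.prems by (intro mult_left_mono) auto
    moreover have "c (Suc i) * ((1 - p) * R i) = p * (c i * R i)"
      using c_Suc[of i] Suc.prems unfolding p_def[symmetric]
      by (simp only: mult.assoc[symmetric]) (simp add: ac_simps)
    ultimately have "p * (c i * R i) \<le> p * (c (Suc i) * R (Suc i))"
      by (simp only: mult.left_commute[of p "c (Suc i)"])
    then have "c i * R i \<le> c (Suc i) * R (Suc i)"
      using p' by simp
    with Suc show ?case
      by simp
  qed
  \<comment> \<open>The clock rate 1/(2 d^2) is chosen for this: 1/4 is the gap between H(0) > 3/4
    and H(d) \<le> 1.\<close>
  have k: "?k * (real d)\<^sup>2 = 1 / 4"
    using d by (simp add: s)
  have "1 / 4 \<le> ?k * (S * (\<Sum>i<d. 1 / c i))"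
    unfolding k[symmetric] S_def
    using square_le_sum_mult_sum_inverse[of d c] c_pos s01 by (intro mult_left_mono) auto
  also have "\<dots> = (\<Sum>i<d. ?k * S / c i)"
    by (simp add: sum_distrib_left)
  also have "\<dots> \<le> (\<Sum>i<d. R i)"
  proof (rule sum_mono)
    fix i assume "i \<in> {..<d}"
    then show "?k * S / c i \<le> R i"
      using L0 R_ge[of i] c_pos[of i] by (simp add: field_simps)
  qed
  also have "\<dots> = (\<Sum>i<d. H (int (Suc i)) - H (int i))"
    by (simp add: R_def add.commute)
  also have "\<dots> = H (int d) - H 0"
    by (subst sum_lessThan_telescope) simp
  finally show False
    using bounds(2)[of "int d"] H0 by simp
qed

section \<open>Survival for d^2/8 steps\<close>

lemma survival_bounds: "0 \<le> survival b d n x \<and> survival b d n x \<le> 1"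
proof (induction n arbitrary: x)
  case (Suc n)
  then show ?case
    using average_mono[of "\<lambda>_. 0" x "survival b d n"] average_mono[of "survival b d n" x "\<lambda>_. 1"]
    by auto
qed simp

text \<open>Hitting \<open>d\<close> within n steps while the clock stays silent for n steps has
  probability s^n (1 - survival), and \<open>H\<close> dominates it.\<close>

lemma survival_ge:
  fixes d :: nat
  assumes d: "1 \<le> d"
  shows "1 / 5 \<le> survival b (int d) (d\<^sup>2 div 8) 0"
proof -
  define s where "s = 1 - 1 / (2 * (real d)\<^sup>2)"
  have d2: "1 \<le> (real d)\<^sup>2"
    using d by simp
  then have s01: "0 \<le> s" "s \<le> 1"
    by (auto simp: s_def divide_le_eq_1)
  obtain H where H: "\<And>x. 0 \<le> H x" "\<And>x. H x \<le> 1" "\<And>x. int d \<le> x \<Longrightarrow> H x = 1"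
    "\<And>x. x < int d \<Longrightarrow> x \<le> - int d \<Longrightarrow> H x = s * H (1 - int d)"
    "\<And>x. x < int d \<Longrightarrow> - int d < x \<Longrightarrow> H x = s * (b x * H (x + 1) + (1 - b x) * H (x - 1))"
    using discounted_hit_limit[OF s01, of "int d"] by metis
  \<comment> \<open>Left of 1 - d, where \<open>H\<close> obeys the reset rule instead, the true
    recursion still holds as an inequality: both neighbours of x \<le> -d have value at most H(1 -
    d).\<close>
  have super: "s * (b x * H (x + 1) + (1 - b x) * H (x - 1)) \<le> H x" if x: "x < int d" for x
  proof (cases "- int d < x")
    case False
    have "H y \<le> H (1 - int d)" if "y \<le> 1 - int d" for y
      using H(4)[of y] that s01 d mult_left_le_one_le[OF H(1)[of "1 - int d"] s01]
      by (cases "y = 1 - int d") auto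
    then have "b x * H (x + 1) + (1 - b x) * H (x - 1) \<le> H (1 - int d)"
      using average_mono[of H x "\<lambda>_. H (1 - int d)"] False by (simp add: algebra_simps)
    then show ?thesis
      using H(4)[of x] False x s01 by (simp add: mult_left_mono)
  qed (use H(5)[of x] x in simp)
  have *: "s ^ n * (1 - survival b (int d) n x) \<le> H x" for n x
  proof (induction n arbitrary: x)
    case 0
    then show ?case
      using H(1,3)[of x] by auto
  next
    case (Suc n)
    let ?v = "survival b (int d) n"
    show ?case
    proof (cases "x < int d")
      case True
      have "s ^ Suc n * (1 - survival b (int d) (Suc n) x) =
          s * (b x * (s ^ n * (1 - ?v (x + 1))) + (1 - b x) * (s ^ n * (1 - ?v (x - 1))))"
        using True by (simp add: algebra_simps)
      also have "\<dots> \<le> s * (b x * H (x + 1) + (1 - b x) * H (x - 1))"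
        using s01 Suc average_mono[of "\<lambda>x. s ^ n * (1 - ?v x)" x H] by (intro mult_left_mono) auto
      also have "\<dots> \<le> H x"
        by (rule super[OF True])
      finally show ?thesis .
    next
      case False
      then show ?thesis
        using H(3)[of x] s01 power_le_one[of s "Suc n"] by simp
    qed
  qed
  define n where "n = d\<^sup>2 div 8"
  have "8 * real n \<le> (real d)\<^sup>2"
  proof -
    have "8 * n \<le> d\<^sup>2"
      by (simp add: n_def)
    then show ?thesis
      by (metis of_nat_le_iff of_nat_mult of_nat_numeral of_nat_power)
  qed
  \<comment> \<open>Bernoulli then gives s^n \<ge> 15/16, so hitting has probability at most
    (3/4)(16/15) = 4/5.\<close>
  then have "real n / (2 * (real d)\<^sup>2) \<le> 1 / 16"
    using d by (subst pos_divide_le_eq) auto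
  then have "15 / 16 \<le> 1 + real n * (- 1 / (2 * (real d)\<^sup>2))"
    by simp
  also have "\<dots> \<le> (1 + (- 1 / (2 * (real d)\<^sup>2))) ^ n"
    using s01 by (intro Bernoulli_inequality) (simp add: s_def)
  also have "\<dots> = s ^ n"
    by (simp add: s_def)
  finally have "15 / 16 * (1 - survival b (int d) n 0) \<le> s ^ n * (1 - survival b (int d) n 0)"
    using survival_bounds[of "int d" n 0] by (intro mult_right_mono) auto
  also have "\<dots> \<le> H 0"
    by (rule *)
  also have "\<dots> \<le> 3 / 4"
  proof (rule discounted_hit_limit_0_le[OF d s_def H(1,2) _ H(5)])
    show "H (- int d) = s * H (1 - int d)"
      using d by (intro H(4)) auto
  qed
  finally show ?thesis
    by (simp add: n_def)
qed

section \<open>Transfer to the law of trajectories\<close>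

text \<open>The Markov property, by induction on the remaining time for all prefixes
  \<open>w\<close>: the two one-step extensions give disjoint events, whose weights come from
  \<open>emeasure_walk_law_path\<close>. With \<sigma> = -1, up and down swap, and
  \<open>b_minus\<close> restores the same recursion.\<close>

lemma survival_le_walk_law_path:
  assumes \<sigma>: "\<sigma> = 1 \<or> \<sigma> = - 1"
  shows "emeasure (walk_law b) {x. \<forall>i\<le>m. x i = w i} * ennreal (survival b d n (\<sigma> * w m))
    \<le> emeasure (walk_law b) {x. (\<forall>i\<le>m. x i = w i) \<and> (\<forall>i\<in>{m..m + n}. \<sigma> * x i < d)}"
proof (induction n arbitrary: m w)
  case 0
  have "{x. (\<forall>i\<le>m. x i = w i) \<and> (\<forall>i\<in>{m..m + 0}. \<sigma> * x i < d)} =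
      (if \<sigma> * w m < d then {x. \<forall>i\<le>m. x i = w i} else {})"
    by auto
  then show ?case
    by auto
next
  case (Suc n)
  have coord [measurable]: "(\<lambda>x. x t) \<in> measurable (walk_law b) (count_space UNIV)" for t
    by measurable
  show ?case
  proof (cases "\<sigma> * w m < d")
    case True
    let ?P = "emeasure (walk_law b) {x. \<forall>i\<le>m. x i = w i}"
    define w' where "w' z = w(Suc m := z)" for z
    define A where "A z = {x. (\<forall>i\<le>Suc m. x i = w' z i) \<and> (\<forall>i\<in>{Suc m..Suc m + n}. \<sigma> * x i < d)}" for z
    have A_sets: "A z \<in> sets (walk_law b)" for z
    proof -
      have "A z = {x \<in> space (walk_law b).
          (\<forall>i\<in>{..Suc m}. x i = w' z i) \<and> (\<forall>i\<in>{Suc m..Suc m + n}. \<sigma> * x i < d)}"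
        by (auto simp: A_def)
      also have "\<dots> \<in> sets (walk_law b)"
        by measurable
      finally show ?thesis .
    qed
    have path: "emeasure (walk_law b) {x. \<forall>i\<le>Suc m. x i = w' z i} = ?P * ennreal (pmf (step b (w m)) z)" for z
      unfolding emeasure_walk_law_path by (auto simp: w'_def intro!: prod.cong arg_cong2[where f="(*)"])
    have A_ge: "?P * ennreal (pmf (step b (w m)) z * survival b d n (\<sigma> * z)) \<le> emeasure (walk_law b) (A z)" for z
      using Suc[of "Suc m" "w' z"] unfolding path A_def
      by (simp add: w'_def ennreal_mult survival_bounds mult.assoc)
    have "survival b d (Suc n) (\<sigma> * w m) =
        pmf (step b (w m)) (w m + 1) * survival b d n (\<sigma> * (w m + 1)) +
        pmf (step b (w m)) (w m - 1) * survival b d n (\<sigma> * (w m - 1))"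
      using \<sigma>
    proof
      assume "\<sigma> = - 1"
      moreover have "- (w m + 1) = - w m - 1" "- (w m - 1) = - w m + 1"
        by auto
      ultimately show ?thesis
        using True by (simp add: pmf_step b_ge_0 b_le_1 b_minus)
    qed (use True in \<open>simp add: pmf_step b_ge_0 b_le_1\<close>)
    then have "?P * ennreal (survival b d (Suc n) (\<sigma> * w m)) =
        ?P * ennreal (pmf (step b (w m)) (w m + 1) * survival b d n (\<sigma> * (w m + 1))) +
        ?P * ennreal (pmf (step b (w m)) (w m - 1) * survival b d n (\<sigma> * (w m - 1)))"
      by (simp add: ennreal_plus survival_bounds distrib_left del: survival.simps)
    also have "\<dots> \<le> emeasure (walk_law b) (A (w m + 1)) + emeasure (walk_law b) (A (w m - 1))"
      by (intro add_mono A_ge)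
    also have "\<dots> = emeasure (walk_law b) (A (w m + 1) \<union> A (w m - 1))"
      by (intro plus_emeasure A_sets) (auto simp: A_def w'_def)
    also have "\<dots> \<le> emeasure (walk_law b)
        {x. (\<forall>i\<le>m. x i = w i) \<and> (\<forall>i\<in>{m..m + Suc n}. \<sigma> * x i < d)}" (is "_ \<le> emeasure _ ?B")
    proof (rule emeasure_mono)
      show "A (w m + 1) \<union> A (w m - 1) \<subseteq> ?B"
      proof
        fix x assume "x \<in> A (w m + 1) \<union> A (w m - 1)"
        then have pre: "x i = w i" if "i \<le> m" for i
          using that by (auto simp: A_def w'_def)
        have "\<sigma> * x i < d" if "i \<in> {m..m + Suc n}" for i
          using that \<open>x \<in> _\<close> pre[of m] True by (cases "i = m") (auto simp: A_def)
        with pre show "x \<in> ?B"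
          by auto
      qed
      have "?B = {x \<in> space (walk_law b).
          (\<forall>i\<in>{..m}. x i = w i) \<and> (\<forall>i\<in>{m..m + Suc n}. \<sigma> * x i < d)}"
        by auto
      also have "\<dots> \<in> sets (walk_law b)"
        by measurable
      finally show "?B \<in> sets (walk_law b)" .
    qed
    finally show ?thesis .
  qed simp
qed

lemma survival_le_walk_law:
  assumes "\<sigma> = 1 \<or> \<sigma> = - 1"
  shows "ennreal (survival b d n 0) \<le> emeasure (walk_law b) {x. \<forall>i\<le>n. \<sigma> * x i < d}"
proof -
  have "ennreal (survival b d n 0) \<le>
      emeasure (walk_law b) {x. (\<forall>i\<le>0. x i = 0) \<and> (\<forall>i\<in>{0..0 + n}. \<sigma> * x i < d)}"
    using survival_le_walk_law_path[OF assms, of 0 "\<lambda>_. 0" d n] emeasure_walk_law_path[of b 0 "\<lambda>_. 0"]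
    by simp
  also have "\<dots> \<le> emeasure (walk_law b) {x. \<forall>i\<le>n. \<sigma> * x i < d}"
  proof (rule emeasure_mono)
    have coord [measurable]: "(\<lambda>x. x t) \<in> measurable (walk_law b) (count_space UNIV)" for t
      by measurable
    have "{x. \<forall>i\<le>n. \<sigma> * x i < d} = {x \<in> space (walk_law b). \<forall>i\<in>{..n}. \<sigma> * x i < d}"
      by auto
    also have "\<dots> \<in> sets (walk_law b)"
      by measurable
    finally show "{x. \<forall>i\<le>n. \<sigma> * x i < d} \<in> sets (walk_law b)" .
  qed auto
  finally show ?thesis .
qed

end

section \<open>The rendezvous bound\<close>

lemma symmetric_walk_signed:
  assumes "admissible a"
  shows "symmetric_walk (signed a)"
proof
  show "0 \<le> signed a x" "signed a x \<le> 1" for x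
    using signed_bounds[OF assms] by auto
  show "signed a (- x) = 1 - signed a x" for x
    using assms by (cases "x = 0") (auto simp: signed_def admissible_def)
qed

lemma expected_rendezvous_time_ge:
  assumes a: "admissible a" and d: "1 \<le> d"
  shows "ennreal (1 / 200 * (real d)\<^sup>2) \<le> expected_rendezvous_time d a"
proof -
  interpret symmetric_walk "signed a"
    by (rule symmetric_walk_signed[OF a])
  let ?M = "walk_law (signed a)"
  interpret M: prob_space ?M
    by (rule prob_space_walk_law)
  define n where "n = d\<^sup>2 div 8"
  define A where "A \<sigma> = {x :: nat \<Rightarrow> int. \<forall>i\<le>n. \<sigma> * x i < int d}" for \<sigma>
  have A_sets [measurable]: "A \<sigma> \<in> sets ?M" for \<sigma>
  proof -
    have coord [measurable]: "(\<lambda>x. x t) \<in> measurable ?M (count_space UNIV)" for t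
      by measurable
    have "A \<sigma> = {x \<in> space ?M. \<forall>i\<in>{..n}. \<sigma> * x i < int d}"
      by (auto simp: A_def)
    also have "\<dots> \<in> sets ?M"
      by measurable
    finally show ?thesis .
  qed
  have A_ge: "ennreal (1 / 5) \<le> emeasure ?M (A \<sigma>)" if "\<sigma> = 1 \<or> \<sigma> = - 1" for \<sigma>
    using survival_le_walk_law[OF that, of "int d" n] ennreal_leI[OF survival_ge[OF d]]
    unfolding A_def n_def by (rule order_trans[rotated])
  \<comment> \<open>The factor is n + 1 because meeting is excluded at all times up to and including
    n. This keeps the bound positive for d = 1, 2, where n = 0.\<close>
  have late: "of_nat (Suc n) * indicator (A 1 \<times> A (- 1)) (x, y) \<le> ennreal_of_enat (rendezvous_time d x y)"
    for x y
  proof (cases "(x, y) \<in> A 1 \<times> A (- 1)")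
    case True
    have "n < t" if t: "x t = y t + 2 * int d" for t
    proof (rule ccontr)
      assume "\<not> n < t"
      then have "x t < int d" "- y t < int d"
        using True by (auto simp: A_def)
      with t show False
        by simp
    qed
    then have "enat (Suc n) \<le> rendezvous_time d x y"
      unfolding rendezvous_time_def by (intro INF_greatest) (simp add: Suc_le_eq)
    then have "ennreal_of_enat (enat (Suc n)) \<le> ennreal_of_enat (rendezvous_time d x y)"
      by (simp only: ennreal_of_enat_le_iff)
    with True show ?thesis
      by (simp add: indicator_def)
  qed simp
  have "m \<le> 8 * Suc (m div 8)" for m :: nat
    by presburger
  then have "d\<^sup>2 \<le> 8 * Suc n"
    unfolding n_def .
  then have "(real d)\<^sup>2 \<le> 8 * real (Suc n)"
    by (metis of_nat_le_iff of_nat_mult of_nat_numeral of_nat_power)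
  \<comment> \<open>1/200 is 1/8 from d^2 \<le> 8 (n + 1), times 1/5 for each agent.\<close>
  then have "ennreal (1 / 200 * (real d)\<^sup>2) \<le> ennreal (real (Suc n) * (1 / 5 * (1 / 5)))"
    by (intro ennreal_leI) simp
  also have "\<dots> = of_nat (Suc n) * (ennreal (1 / 5) * ennreal (1 / 5))"
    by (simp only: ennreal_mult ennreal_of_nat_eq_real_of_nat zero_le_divide_1_iff of_nat_0_le_iff
        zero_le_numeral mult_nonneg_nonneg)
  also have "\<dots> \<le> of_nat (Suc n) * (emeasure ?M (A 1) * emeasure ?M (A (- 1)))"
    by (intro mult_left_mono mult_mono A_ge) auto
  also have "\<dots> = of_nat (Suc n) * emeasure (?M \<Otimes>\<^sub>M ?M) (A 1 \<times> A (- 1))"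
    by (subst M.emeasure_pair_measure_Times) auto
  also have "\<dots> = (\<integral>\<^sup>+z. of_nat (Suc n) * indicator (A 1 \<times> A (- 1)) z \<partial>(?M \<Otimes>\<^sub>M ?M))"
    by (subst nn_integral_cmult_indicator) auto
  also have "\<dots> \<le> expected_rendezvous_time d a"
    unfolding expected_rendezvous_time_def
    by (intro nn_integral_mono) (use late in \<open>auto simp del: of_nat_Suc\<close>)
  finally show ?thesis .
qed

theorem theorem2:
  shows "\<exists>c::real. c > 0 \<and>
    (\<forall>d::nat. d \<ge> 1 \<longrightarrow> ennreal (c * (real d)\<^sup>2) \<le> optimal_rendezvous_time d)"
proof (intro exI[of _ "1 / 200"] conjI allI impI)
  fix d :: nat assume "1 \<le> d"
  then show "ennreal (1 / 200 * (real d)\<^sup>2) \<le> optimal_rendezvous_time d"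
    unfolding optimal_rendezvous_time_def
    by (intro INF_greatest expected_rendezvous_time_ge) auto
qed simp

end
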